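(* Let $p_1,p_2\ge 2$, $p=p_1p_2$, and let $r\le p$ be an integer with $p_1/p_2+p_2/p_1<r$. Let $C\in\mathcal{C}_{p_1,p_2}^{++}$ and suppose $C=BB^\top+\lambda I_p$ for some $B\in\mathbb{R}^{p\times r}$ of rank $r$ and some constant $\lambda>0$. Then $\lambda\in(0,1)$ and $BB^\top=(1-\lambda)AA^\top$ for some $A\in\mathbb{R}^{p\times r}$ of rank $r$ such that $AA^\top$ is a rank-$r$ core.
   Context: $\mathcal{S}_q$ (resp. $\mathcal{S}_q^{++}$) is the set of real symmetric (resp. symmetric positive definite) $q\times q$ matrices. Partial traces: partition $M\in\mathcal{S}_p$ into $p_2\times p_2$ blocks $M_{[i,j]}\in\mathbb{R}^{p_1\times p_1}$; then $\mathrm{tr}_1(M)=\sum_{i=1}^{p_2}M_{[i,i]}\in\mathcal{S}_{p_1}$ and $\mathrm{tr}_2(M)\in\mathcal{S}_{p_2}$ is the matrix with $(i,j)$ entry $\mathrm{tr}(M_{[i,j]})$. Kronecker map: for $\Sigma\in\mathcal{S}_p^{++}$, $k(\Sigma)$ is the unique minimizer of $d(K_2\otimes K_1|\Sigma)=\mathrm{tr}(\Sigma (K_2\otimes K_1)^{-1})+p_1\log|K_2|+p_2\log|K_1|$ over $\{K_2\otimes K_1: K_i\in\mathcal{S}_{p_i}^{++}\}$ (it exists and is unique). $\mathcal{C}_{p_1,p_2}^{++}=\{C\in\mathcal{S}_p^{++}:k(C)=I_p\}$; equivalently, $\mathcal{C}_{p_1,p_2}^{++}=\{C\in\mathcal{S}_p^{++}:\mathrm{tr}_1(C)=p_2I_{p_1},\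 \mathrm{tr}_2(C)=p_1I_{p_2}\}$. A rank-$r$ core is a positive semidefinite $p\times p$ matrix $C$ of rank $r$ with $\mathrm{tr}_1(C)=p_2I_{p_1}$ and $\mathrm{tr}_2(C)=p_1I_{p_2}$. *)

theory Defs
  imports "HOL-Analysis.Analysis"
begin

text \<open>
  Throughout, \<open>p\<^sub>1 = CARD('p1)\<close> and \<open>p\<^sub>2 = CARD('p2)\<close>.  A \<open>p \<times> p\<close> matrix with
  \<open>p = p\<^sub>1 p\<^sub>2\<close> is indexed by \<open>'p2 \<times> 'p1\<close>: the index \<open>(i, a)\<close> is the
  \<open>a\<close>-th position inside the \<open>i\<close>-th block, so the blocks are \<open>p\<^sub>1 \<times> p\<^sub>1\<close> and there are
  \<open>p\<^sub>2 \<times> p\<^sub>2\<close> of them.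
\<close>

definition sym_mat :: "real^'n^'n \<Rightarrow> bool" where
  "sym_mat M \<longleftrightarrow> transpose M = M"

definition pos_def :: "real^'n^'n \<Rightarrow> bool" where
  "pos_def M \<longleftrightarrow> sym_mat M \<and> (\<forall>x. x \<noteq> 0 \<longrightarrow> 0 < x \<bullet> (M *v x))"

definition pos_semidef :: "real^'n^'n \<Rightarrow> bool" where
  "pos_semidef M \<longleftrightarrow> sym_mat M \<and> (\<forall>x. 0 \<le> x \<bullet> (M *v x))"

definition block :: "real^('p2::finite \<times> 'p1::finite)^('p2 \<times> 'p1) \<Rightarrow> 'p2 \<Rightarrow> 'p2 \<Rightarrow> real^'p1^'p1" where
  "block M i j = (\<chi> a b. M $ (i, a) $ (j, b))"

definition ptrace1 :: "real^('p2::finite \<times> 'p1::finite)^('p2 \<times> 'p1) \<Rightarrow> real^'p1^'p1" where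
  "ptrace1 M = (\<Sum>i\<in>UNIV. block M i i)"

definition ptrace2 :: "real^('p2::finite \<times> 'p1::finite)^('p2 \<times> 'p1) \<Rightarrow> real^'p2^'p2" where
  "ptrace2 M = (\<chi> i j. trace (block M i j))"

definition kron ::
    "real^'p2^'p2 \<Rightarrow> real^'p1^'p1 \<Rightarrow> real^('p2::finite \<times> 'p1::finite)^('p2 \<times> 'p1)" where
  "kron K2 K1 = (\<chi> u v. K2 $ fst u $ fst v * K1 $ snd u $ snd v)"

definition kron_divergence ::
    "real^'p2^'p2 \<Rightarrow> real^'p1^'p1 \<Rightarrow> real^('p2::finite \<times> 'p1::finite)^('p2 \<times> 'p1) \<Rightarrow> real" where
  "kron_divergence K2 K1 S =
     trace (S ** matrix_inv (kron K2 K1))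
       + real CARD('p1) * ln (det K2) + real CARD('p2) * ln (det K1)"

text \<open>
  The factors \<open>K2\<close> and \<open>K1\<close> are determined by \<open>kron K2 K1\<close> only up to
  \<open>(c K2, K1 / c)\<close>; the divergence does not depend on this choice.  Uniqueness of the minimizer
  therefore refers to the product \<open>K\<close>, not to the factors.
\<close>

definition is_kron_minimizer ::
    "real^('p2::finite \<times> 'p1::finite)^('p2 \<times> 'p1) \<Rightarrow> real^('p2 \<times> 'p1)^('p2 \<times> 'p1) \<Rightarrow> bool" where
  "is_kron_minimizer S K \<longleftrightarrow>
     (\<exists>K2 K1. pos_def K2 \<and> pos_def K1 \<and> K = kron K2 K1 \<and>
        (\<forall>L2 L1. pos_def L2 \<and> pos_def L1 \<longrightarrow>
           kron_divergence K2 K1 S \<le> kron_divergence L2 L1 S))"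

text \<open>
  For positive definite \<open>S\<close> the minimizer exists and is unique; the value \<open>0\<close>, which is
  not positive definite, only makes the map total on arguments without a unique minimizer.
\<close>

definition kron_map ::
    "real^('p2::finite \<times> 'p1::finite)^('p2 \<times> 'p1) \<Rightarrow> real^('p2 \<times> 'p1)^('p2 \<times> 'p1)" where
  "kron_map S =
     (if \<exists>!K. is_kron_minimizer S K then THE K. is_kron_minimizer S K else 0)"

definition pd_cores :: "(real^('p2::finite \<times> 'p1::finite)^('p2 \<times> 'p1)) set" where
  "pd_cores = {C. pos_def C \<and> kron_map C = mat 1}"

definition is_rank_core :: "nat \<Rightarrow> real^('p2::finite \<times> 'p1::finite)^('p2 \<times> 'p1) \<Rightarrow> bool" where
  "is_rank_core r C \<longleftrightarrow>
     pos_semidef C \<and> rank C = r \<and>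
     ptrace1 C = real CARD('p2) *\<^sub>R mat 1 \<and>
     ptrace2 C = real CARD('p1) *\<^sub>R mat 1"

end

theory Submission
  imports Defs
begin

text \<open>
  If the identity minimizes the divergence of \<open>C\<close>, then comparing it with the competitors whose
  inverse is \<open>I \<otimes> Y\<^sup>T Y\<close> or \<open>Y\<^sup>T Y \<otimes> I\<close>, with \<open>Y = I + t E\<^sub>a\<^sub>b\<close> and \<open>t\<close> near \<open>0\<close>,
  forces both partial traces of \<open>C\<close> to be those of the identity.
  By linearity \<open>B B\<^sup>T = C - \<lambda> I\<close> then has \<open>1 - \<lambda>\<close> times the partial traces of the identity; taking the
  full trace, \<open>(1 - \<lambda>) p\<close> is the squared Frobenius norm of \<open>B \<noteq> 0\<close>, so \<open>\<lambda> < 1\<close>,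
  and \<open>A = B / sqrt (1 - \<lambda>)\<close> works.
\<close>

section \<open>Kronecker products and partial traces\<close>

text \<open>The sum over index pairs factors into one sum per tensor factor. Together with
  \<open>kron_mat_1\<close> this inverts a Kronecker product factor by factor.\<close>

lemma kron_mult:
  fixes A2 B2 :: "real^'p2::finite^'p2" and A1 B1 :: "real^'p1::finite^'p1"
  shows "kron A2 A1 ** kron B2 B1 = kron (A2 ** B2) (A1 ** B1)"
  unfolding vec_eq_iff
proof (intro allI)
  fix u v :: "'p2 \<times> 'p1"
  have "(kron A2 A1 ** kron B2 B1) $ u $ v =
    (\<Sum>(i, a)\<in>UNIV \<times> UNIV. A2 $ fst u $ i * A1 $ snd u $ a * (B2 $ i $ fst v * B1 $ a $ snd v))"
    by (simp add: kron_def matrix_matrix_mult_def case_prod_beta)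
  also have "\<dots> = kron (A2 ** B2) (A1 ** B1) $ u $ v"
    unfolding sum.cartesian_product[symmetric]
    unfolding kron_def matrix_matrix_mult_def vec_lambda_beta sum_product
    by (intro sum.cong refl) (simp add: mult_ac)
  finally show "(kron A2 A1 ** kron B2 B1) $ u $ v = kron (A2 ** B2) (A1 ** B1) $ u $ v" .
qed

lemma kron_mat_1: "kron (mat 1) (mat 1) = mat 1"
  by (auto simp: kron_def mat_def vec_eq_iff prod_eq_iff)

lemma trace_ptrace1:
  fixes M :: "real^('p2::finite \<times> 'p1::finite)^('p2 \<times> 'p1)"
  shows "trace (ptrace1 M) = trace M"
proof -
  have "trace M = (\<Sum>(i, a)\<in>UNIV \<times> UNIV. M $ (i, a) $ (i, a))"
    by (simp add: trace_def case_prod_beta)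
  also have "\<dots> = (\<Sum>a\<in>UNIV. \<Sum>i\<in>UNIV. M $ (i, a) $ (i, a))"
    by (subst sum.swap) (simp add: sum.cartesian_product)
  finally show ?thesis
    by (simp add: trace_def ptrace1_def block_def)
qed

text \<open>For the trace pairing, \<open>ptrace1\<close> is adjoint to tensoring with the identity,
  because the identity factor keeps only the diagonal blocks. A competitor that varies one Kronecker
  factor thus sees \<open>M\<close> only through a partial trace.\<close>

lemma trace_mult_kron_ptrace1:
  fixes M :: "real^('p2::finite \<times> 'p1::finite)^('p2 \<times> 'p1)"
  shows "trace (M ** kron (mat 1) P) = trace (ptrace1 M ** P)"
proof -
  have "trace (M ** kron (mat 1) P) =
      (\<Sum>(i, a)\<in>UNIV \<times> UNIV. \<Sum>(j, b)\<in>UNIV \<times> UNIV.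
        M $ (i, a) $ (j, b) * ((if j = i then 1 else 0) * P $ b $ a))"
    by (simp add: trace_def matrix_matrix_mult_def kron_def mat_def case_prod_beta)
  also have "\<dots> = (\<Sum>i\<in>UNIV. \<Sum>a\<in>UNIV. \<Sum>b\<in>UNIV. M $ (i, a) $ (i, b) * P $ b $ a)"
    unfolding sum.cartesian_product[symmetric]
    by (intro sum.cong refl, subst sum.swap)
       (simp add: if_distrib[of "\<lambda>x. x * _"] if_distrib[of "\<lambda>x. _ * x"] cong: if_cong)
  also have "\<dots> = (\<Sum>a\<in>UNIV. \<Sum>b\<in>UNIV. \<Sum>i\<in>UNIV. M $ (i, a) $ (i, b) * P $ b $ a)"
    by (subst sum.swap) (intro sum.cong refl sum.swap)
  also have "\<dots> = trace (ptrace1 M ** P)"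
    by (simp add: trace_def matrix_matrix_mult_def ptrace1_def block_def sum_distrib_right)
  finally show ?thesis .
qed

lemma trace_mult_kron_ptrace2:
  fixes M :: "real^('p2::finite \<times> 'p1::finite)^('p2 \<times> 'p1)"
  shows "trace (M ** kron P (mat 1)) = trace (ptrace2 M ** P)"
proof -
  have "trace (M ** kron P (mat 1)) =
      (\<Sum>(i, a)\<in>UNIV \<times> UNIV. \<Sum>(j, b)\<in>UNIV \<times> UNIV.
        M $ (i, a) $ (j, b) * (P $ j $ i * (if b = a then 1 else 0)))"
    by (simp add: trace_def matrix_matrix_mult_def kron_def mat_def case_prod_beta)
  also have "\<dots> = (\<Sum>i\<in>UNIV. \<Sum>a\<in>UNIV. \<Sum>j\<in>UNIV. M $ (i, a) $ (j, a) * P $ j $ i)"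
    unfolding sum.cartesian_product[symmetric]
    by (intro sum.cong refl)
       (simp add: if_distrib[of "\<lambda>x. _ * x"] cong: if_cong)
  also have "\<dots> = (\<Sum>i\<in>UNIV. \<Sum>j\<in>UNIV. \<Sum>a\<in>UNIV. M $ (i, a) $ (j, a) * P $ j $ i)"
    by (intro sum.cong refl sum.swap)
  also have "\<dots> = trace (ptrace2 M ** P)"
    by (simp add: trace_def matrix_matrix_mult_def ptrace2_def block_def sum_distrib_right)
  finally show ?thesis .
qed

lemma sym_mat_ptrace1: "sym_mat M \<Longrightarrow> sym_mat (ptrace1 M)"
  by (auto simp: sym_mat_def ptrace1_def block_def transpose_def vec_eq_iff)

lemma sym_mat_ptrace2: "sym_mat M \<Longrightarrow> sym_mat (ptrace2 M)"
  by (auto simp: sym_mat_def ptrace2_def block_def transpose_def vec_eq_iff trace_def)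

section \<open>Gram matrices: definiteness, rank, trace and inverse\<close>

lemma pos_def_transpose_mult:
  fixes Y :: "real^'n::finite^'n"
  assumes "invertible Y"
  shows "pos_def (transpose Y ** Y)"
  unfolding pos_def_def
proof (intro conjI allI impI)
  show "sym_mat (transpose Y ** Y)"
    by (simp add: sym_mat_def matrix_transpose_mul)
  fix x :: "real^'n"
  assume "x \<noteq> 0"
  then have "Y *v x \<noteq> 0"
    using assms by (metis invertible_left_inverse matrix_left_invertible_ker)
  moreover have "x \<bullet> ((transpose Y ** Y) *v x) = (Y *v x) \<bullet> (Y *v x)"
    by (simp add: matrix_vector_mul_assoc[symmetric] dot_lmul_matrix inner_commute[of x])
  ultimately show "0 < x \<bullet> ((transpose Y ** Y) *v x)"
    by simp
qed

lemma pos_semidef_mult_transpose: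
  fixes A :: "real^'m::finite^'n::finite"
  shows "pos_semidef (A ** transpose A)"
  unfolding pos_semidef_def
proof (intro conjI allI)
  show "sym_mat (A ** transpose A)"
    by (simp add: sym_mat_def matrix_transpose_mul)
  fix x :: "real^'n"
  have "x \<bullet> ((A ** transpose A) *v x) = (transpose A *v x) \<bullet> (transpose A *v x)"
    by (simp add: matrix_vector_mul_assoc[symmetric] dot_lmul_matrix[symmetric])
  then show "0 \<le> x \<bullet> ((A ** transpose A) *v x)"
    by simp
qed

text \<open>Full column rank makes \<open>transpose A\<close> surjective, so composing with it does
  not shrink the range of \<open>A\<close>.\<close>

lemma rank_mult_transpose_full_rank:
  fixes A :: "real^'m::finite^'n::finite"
  assumes "rank A = CARD('m)"
  shows "rank (A ** transpose A) = CARD('m)"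
proof -
  have "surj ((*v) (transpose A))"
    using assms by (simp only: full_rank_surjective[symmetric] rank_transpose)
  then have "range ((*v) (A ** transpose A)) = range ((*v) A)"
    unfolding matrix_vector_mul_assoc[symmetric] by (metis image_image)
  then show ?thesis
    using assms by (simp add: rank_dim_range)
qed

lemma trace_mult_transpose:
  fixes B :: "real^'m::finite^'n::finite"
  shows "trace (B ** transpose B) = (\<Sum>i\<in>UNIV. \<Sum>j\<in>UNIV. (B $ i $ j)\<^sup>2)"
  by (simp add: trace_def matrix_matrix_mult_def transpose_def power2_eq_square)

text \<open>\<open>transpose Y ** Y\<close> is the sum of the outer products of the rows of
  \<open>Y\<close> with themselves. Changing a single row of \<open>Y\<close> therefore changes a
  single summand.\<close>

lemma trace_mult_transpose_mult:
  fixes M Y :: "real^'n::finite^'n"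
  shows "trace (M ** (transpose Y ** Y)) = (\<Sum>i\<in>UNIV. Y $ i \<bullet> (M *v Y $ i))"
proof -
  have "trace (M ** (transpose Y ** Y)) = trace (Y ** (M ** transpose Y))"
    by (subst trace_mul_sym[of Y]) (simp add: matrix_mul_assoc)
  also have "\<dots> = (\<Sum>i\<in>UNIV. Y $ i \<bullet> (M *v Y $ i))"
    by (simp add: trace_def matrix_matrix_mult_def transpose_def inner_vec_def matrix_vector_mult_def)
  finally show ?thesis .
qed

lemma matrix_inv_eqI:
  fixes A B :: "real^'n::finite^'n"
  assumes "A ** B = mat 1" and "B ** A = mat 1"
  shows "matrix_inv A = B"
  unfolding matrix_inv_def
proof (rule some_equality)
  show "A ** B = mat 1 \<and> B ** A = mat 1"
    using assms by simp
  fix X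
  assume "A ** X = mat 1 \<and> X ** A = mat 1"
  then have "X ** (A ** B) = B"
    by (simp only: matrix_mul_assoc matrix_mul_lid)
  then show "X = B"
    using assms by simp
qed

lemma invertible_mat_1: "invertible (mat 1 :: real^'n::finite^'n)"
  by (auto simp: invertible_def)

text \<open>The divergence contains the inverse of its argument. Taking
  \<open>X ** transpose X\<close> as a factor, with \<open>X\<close> the inverse of
  \<open>Y\<close>, makes that inverse the explicit Gram matrix of \<open>Y\<close> and flips the
  sign of the log-determinant.\<close>

lemma gram_inverse:
  fixes X Y :: "real^'n::finite^'n"
  assumes XY: "Y ** X = mat 1" "X ** Y = mat 1"
  shows "pos_def (X ** transpose X)"
    and "(X ** transpose X) ** (transpose Y ** Y) = mat 1"
    and "(transpose Y ** Y) ** (X ** transpose X) = mat 1"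
    and "ln (det (X ** transpose X)) = - ln ((det Y)\<^sup>2)"
proof -
  have t: "transpose X ** transpose Y = mat 1" "transpose Y ** transpose X = mat 1"
    using XY by (metis matrix_transpose_mul transpose_mat)+
  show "pos_def (X ** transpose X)"
    using pos_def_transpose_mult[of "transpose X"] t by (auto simp: invertible_def)
  have "(X ** transpose X) ** (transpose Y ** Y) = X ** (transpose X ** transpose Y) ** Y"
    by (simp only: matrix_mul_assoc)
  then show "(X ** transpose X) ** (transpose Y ** Y) = mat 1"
    by (simp add: t XY)
  have "(transpose Y ** Y) ** (X ** transpose X) = transpose Y ** (Y ** X) ** transpose X"
    by (simp only: matrix_mul_assoc)
  then show "(transpose Y ** Y) ** (X ** transpose X) = mat 1"
    by (simp add: t XY)
  have "det X * det Y = 1"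
    using XY by (metis det_mul det_I)
  then have "det X = inverse (det Y)" "det Y \<noteq> 0"
    using inverse_unique[of "det Y" "det X"] by (auto simp: mult.commute)
  then have "det (X ** transpose X) = inverse ((det Y)\<^sup>2)" "(det Y)\<^sup>2 > 0"
    by (auto simp: det_mul power2_eq_square zero_less_mult_iff)
  then show "ln (det (X ** transpose X)) = - ln ((det Y)\<^sup>2)"
    by (simp add: ln_inverse)
qed

section \<open>First-order conditions when the identity is a Kronecker minimizer\<close>

text \<open>The minimizer is given only as some \<open>kron K2 K1\<close> equal to the identity.
  This forces \<open>K1\<close> to be \<open>d\<close> times the identity and \<open>K2\<close> to
  be \<open>inverse d\<close> times the identity, and the divergence at these factors is
  \<open>trace C\<close> for every \<open>d > 0\<close>.\<close>

lemma is_kron_minimizer_mat_1D: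
  fixes C :: "real^('p2::finite \<times> 'p1::finite)^('p2 \<times> 'p1)"
  assumes "is_kron_minimizer C (mat 1)" and "pos_def L2" and "pos_def L1"
  shows "trace C \<le> kron_divergence L2 L1 C"
proof -
  obtain K2 :: "real^'p2^'p2" and K1 :: "real^'p1^'p1"
    where K1: "pos_def K1" and K: "mat 1 = kron K2 K1"
      and le: "kron_divergence K2 K1 C \<le> kron_divergence L2 L1 C"
    using assms unfolding is_kron_minimizer_def by metis
  \<comment> \<open>Any fixed pair of indices serves: entry \<open>(a, a)\<close> of
    \<open>K1\<close> defines \<open>d\<close>, and entry \<open>(i, i)\<close> of \<open>K2\<close>
    is then its inverse.\<close>
  define a :: 'p1 where "a = undefined"
  define i :: 'p2 where "i = undefined"
  define d where "d = K1 $ a $ a"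
  have entry: "K2 $ j $ j' * K1 $ b $ b' = (if j = j' \<and> b = b' then 1 else 0)" for j j' b b'
  proof -
    have "kron K2 K1 $ (j, b) $ (j', b') = mat 1 $ (j, b) $ (j', b')"
      using K by simp
    then show ?thesis
      by (simp add: kron_def mat_def)
  qed
  have "0 < axis a 1 \<bullet> (K1 *v axis a 1)"
    using K1 by (auto simp: pos_def_def axis_eq_0_iff)
  then have d: "d > 0"
    by (simp add: d_def inner_axis' matrix_vector_mul_component inner_axis)
  have K2: "K2 $ j $ j' = (if j = j' then inverse d else 0)" for j j'
    using entry[of j j' a a] d by (auto simp: d_def field_simps split: if_splits)
  have K1: "K1 $ b $ b' = (if b = b' then d else 0)" for b b'
    using entry[of i i b b'] d by (auto simp: K2 field_simps split: if_splits)
  have "det K1 = d ^ CARD('p1)"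
    by (subst det_diagonal) (auto simp: K1)
  moreover have "det K2 = inverse d ^ CARD('p2)"
    by (subst det_diagonal) (auto simp: K2)
  moreover have "matrix_inv (mat 1 :: real^('p2 \<times> 'p1)^('p2 \<times> 'p1)) = mat 1"
    by (rule matrix_inv_eqI) auto
  \<comment> \<open>The log-determinant terms are \<open>- p1 * p2 * ln d\<close> and
    \<open>p2 * p1 * ln d\<close>, with \<open>p1\<close> and \<open>p2\<close> the two dimensions,
    so they cancel.\<close>
  ultimately have "kron_divergence K2 K1 C = trace C"
    using d by (simp add: kron_divergence_def K[symmetric] ln_realpow ln_inverse)
  with le show ?thesis by simp
qed

lemma is_kron_minimizer_mat_1_gram:
  fixes C :: "real^('p2::finite \<times> 'p1::finite)^('p2 \<times> 'p1)"
  assumes "is_kron_minimizer C (mat 1)" and Y2: "invertible Y2" and Y1: "invertible Y1"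
  shows "trace C \<le> trace (C ** kron (transpose Y2 ** Y2) (transpose Y1 ** Y1))
    - real CARD('p1) * ln ((det Y2)\<^sup>2) - real CARD('p2) * ln ((det Y1)\<^sup>2)"
proof -
  obtain X2 where X2: "Y2 ** X2 = mat 1" "X2 ** Y2 = mat 1"
    using Y2 by (auto simp: invertible_def)
  obtain X1 where X1: "Y1 ** X1 = mat 1" "X1 ** Y1 = mat 1"
    using Y1 by (auto simp: invertible_def)
  note 1 = gram_inverse[OF X1] and 2 = gram_inverse[OF X2]
  have "matrix_inv (kron (X2 ** transpose X2) (X1 ** transpose X1)) =
      kron (transpose Y2 ** Y2) (transpose Y1 ** Y1)"
    using 1 2 by (intro matrix_inv_eqI) (simp_all only: kron_mult kron_mat_1)
  then show ?thesis
    using is_kron_minimizer_mat_1D[OF assms(1), of "X2 ** transpose X2" "X1 ** transpose X1"] 1 2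
    by (simp add: kron_divergence_def)
qed

text \<open>
  First-order condition along the curves \<open>Y\<^sub>t = I + t E\<^sub>a\<^sub>b\<close>: the right-hand side, as a function of
  \<open>t\<close>, is minimal at \<open>0\<close>, where its derivative is \<open>2 (M\<^sub>a\<^sub>b - c \<delta>\<^sub>a\<^sub>b)\<close>.
\<close>

lemma trace_log_det_stationary:
  fixes M :: "real^'n::finite^'n"
  assumes "sym_mat M"
    and min: "\<And>Y. invertible Y \<Longrightarrow> trace M \<le> trace (M ** (transpose Y ** Y)) - c * ln ((det Y)\<^sup>2)"
  shows "M = c *\<^sub>R mat 1"
proof -
  have sym: "M $ i $ j = M $ j $ i" for i j
    using assms(1) unfolding sym_mat_def transpose_def by (metis vec_lambda_beta)
  have "M $ a $ b = (if a = b then c else 0)" for a b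
  proof -
    \<comment> \<open>\<open>1 + t * \<delta>\<close> is the determinant of the identity plus
      \<open>t\<close> times the matrix unit at \<open>(a, b)\<close>; \<open>f\<close> is the
      change of the objective along this curve.\<close>
    define \<delta> :: real where "\<delta> = (if a = b then 1 else 0)"
    define f where "f t = 2 * t * M $ a $ b + t\<^sup>2 * M $ b $ b - 2 * c * ln (1 + t * \<delta>)" for t
    have "f 0 \<le> f t" if t: "\<bar>t\<bar> < 1" for t
    proof -
      define Y :: "real^'n^'n" where
        "Y = (\<chi> i. if i = a then axis a 1 + t *s axis b 1 else axis i 1)"
      \<comment> \<open>The bound on \<open>t\<close> matters for \<open>a = b\<close>: it keeps the
        determinant positive, hence \<open>Y\<close> invertible and the logarithm of its square
        equal to twice its logarithm.\<close>
      have pos: "1 + t * \<delta> > 0"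
        using t by (auto simp: \<delta>_def)
      have det: "det Y = 1 + t * \<delta>"
      proof (cases "a = b")
        case True
        then have "det Y = (\<Prod>i\<in>UNIV. if i = a then 1 + t else 1)"
          by (subst det_diagonal) (auto simp: Y_def axis_def simp del: prod.delta intro!: prod.cong)
        with True show ?thesis by (simp add: \<delta>_def)
      next
        case False
        \<comment> \<open>Off the diagonal, \<open>Y\<close> arises from the identity by adding a
          multiple of one row to another, which preserves the determinant.\<close>
        have "Y = (\<chi> k. if k = a then row a (mat 1) + t *s row b (mat 1) else row k (mat 1))"
          by (auto simp: Y_def vec_eq_iff row_def mat_def axis_def)
        with False show ?thesis
          by (simp add: det_row_operation \<delta>_def)
      qed
      have ln: "ln ((det Y)\<^sup>2) = 2 * ln (1 + t * \<delta>)"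
        using pos by (simp add: det ln_realpow)
      have q: "axis i 1 \<bullet> (M *v axis j 1) = M $ i $ j" for i j
        by (simp add: inner_axis' matrix_vector_mul_component inner_axis)
      \<comment> \<open>Only row \<open>a\<close> differs from the identity; symmetry of
        \<open>M\<close> merges the two cross terms of its quadratic form into
        \<open>2 * t * M $ a $ b\<close>.\<close>
      have "trace (M ** (transpose Y ** Y)) =
          (\<Sum>i\<in>UNIV. M $ i $ i + (if i = a then 2 * t * M $ a $ b + t\<^sup>2 * M $ b $ b else 0))"
        unfolding trace_mult_transpose_mult
        by (intro sum.cong refl)
           (auto simp: Y_def q matrix_vector_right_distrib inner_add_left inner_add_right
              scalar_mult_eq_scaleR matrix_vector_mult_scaleR sym[of b a] power2_eq_square algebra_simps)
      also have "\<dots> = trace M + 2 * t * M $ a $ b + t\<^sup>2 * M $ b $ b"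
        by (simp add: sum.distrib trace_def)
      finally show ?thesis
        using min[of Y] pos by (simp add: f_def ln[unfolded det] det invertible_det_nz)
    qed
    moreover have "(f has_real_derivative 2 * M $ a $ b - 2 * c * \<delta>) (at 0)"
      unfolding f_def by (auto intro!: derivative_eq_intros)
    ultimately have "2 * M $ a $ b - 2 * c * \<delta> = 0"
      using DERIV_local_min[of f "2 * M $ a $ b - 2 * c * \<delta>" 0 1] by simp
    then show ?thesis
      by (simp add: \<delta>_def split: if_splits)
  qed
  then show ?thesis
    by (simp add: vec_eq_iff mat_def)
qed

lemma pd_cores_ptraces:
  fixes C :: "real^('p2::finite \<times> 'p1::finite)^('p2 \<times> 'p1)"
  assumes "C \<in> pd_cores"
  shows "ptrace1 C = real CARD('p2) *\<^sub>R mat 1" and "ptrace2 C = real CARD('p1) *\<^sub>R mat 1"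
proof -
  have pd: "pos_def C" and k: "kron_map C = mat 1"
    using assms by (auto simp: pd_cores_def)
  \<comment> \<open>The default value \<open>0\<close> of \<open>kron_map\<close> is not the
    identity, so \<open>kron_map C = mat 1\<close> must come from the branch with a unique
    minimizer.\<close>
  have "(mat 1 :: real^('p2 \<times> 'p1)^('p2 \<times> 'p1)) \<noteq> 0"
    by (auto simp: vec_eq_iff mat_def)
  then have "\<exists>!K. is_kron_minimizer C K"
    using k by (auto simp: kron_map_def split: if_splits)
  then have min: "is_kron_minimizer C (mat 1)"
    using k theI'[of "is_kron_minimizer C"] by (simp add: kron_map_def)
  have sym: "sym_mat C"
    using pd by (simp add: pos_def_def)
  have "trace (ptrace2 C) = trace C"
    using trace_mult_kron_ptrace2[of C "mat 1"] by (simp add: kron_mat_1)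
  \<comment> \<open>Fixing \<open>Y1\<close> as the identity leaves a problem in \<open>Y2\<close>
    alone, with \<open>M = ptrace2 C\<close> and \<open>c = real CARD('p1)\<close>. The other
    partial trace follows with the roles exchanged.\<close>
  then show "ptrace2 C = real CARD('p1) *\<^sub>R mat 1"
    using is_kron_minimizer_mat_1_gram[OF min _ invertible_mat_1]
    by (intro trace_log_det_stationary sym_mat_ptrace2 sym)
       (simp add: trace_mult_kron_ptrace2 transpose_mat)
  show "ptrace1 C = real CARD('p2) *\<^sub>R mat 1"
    using is_kron_minimizer_mat_1_gram[OF min invertible_mat_1]
    by (intro trace_log_det_stationary sym_mat_ptrace1 sym)
       (simp add: trace_mult_kron_ptrace1 trace_ptrace1 transpose_mat)
qed

section \<open>Rescaling to a rank-\<open>r\<close> core\<close>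

lemma ptrace1_affine:
  fixes M :: "real^('p2::finite \<times> 'p1::finite)^('p2 \<times> 'p1)"
  shows "ptrace1 (s *\<^sub>R (M - l *\<^sub>R mat 1)) = s *\<^sub>R (ptrace1 M - (l * real CARD('p2)) *\<^sub>R mat 1)"
  by (auto simp: ptrace1_def block_def mat_def vec_eq_iff sum_distrib_left[symmetric] sum_subtractf)

lemma ptrace2_affine:
  fixes M :: "real^('p2::finite \<times> 'p1::finite)^('p2 \<times> 'p1)"
  shows "ptrace2 (s *\<^sub>R (M - l *\<^sub>R mat 1)) = s *\<^sub>R (ptrace2 M - (l * real CARD('p1)) *\<^sub>R mat 1)"
  by (auto simp: ptrace2_def block_def trace_def mat_def vec_eq_iff sum_distrib_left[symmetric] sum_subtractf)

lemma scaleR_mat_1_normalize: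
  fixes l k :: real
  assumes "l < 1"
  shows "(1 / (1 - l)) *\<^sub>R (k *\<^sub>R mat 1 - (l * k) *\<^sub>R mat 1) = k *\<^sub>R (mat 1 :: real^'n::finite^'n)"
proof -
  have "k - l * k = k * (1 - l)"
    by (simp add: algebra_simps)
  then have "(1 / (1 - l)) * (k - l * k) = k"
    using assms by simp
  then show ?thesis
    by (simp only: scaleR_diff_left[symmetric] scaleR_scaleR)
qed

theorem proposition2p2:
  fixes C :: "real^('p2::finite \<times> 'p1::finite)^('p2 \<times> 'p1)"
    and B :: "real^'r::finite^('p2 \<times> 'p1)"
    and l :: real
  assumes "CARD('p1) \<ge> 2" and "CARD('p2) \<ge> 2"
    and "CARD('r) \<le> CARD('p1) * CARD('p2)"
    and "real CARD('p1) / real CARD('p2) + real CARD('p2) / real CARD('p1) < real CARD('r)"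
    and "C \<in> pd_cores"
    and "rank B = CARD('r)"
    and "l > 0"
    and "C = B ** transpose B + l *\<^sub>R mat 1"
  shows "l \<in> {0<..<1} \<and>
    (\<exists>A :: real^'r^('p2 \<times> 'p1). rank A = CARD('r) \<and>
       B ** transpose B = (1 - l) *\<^sub>R (A ** transpose A) \<and>
       is_rank_core CARD('r) (A ** transpose A))"
proof -
  note pt = pd_cores_ptraces[OF \<open>C \<in> pd_cores\<close>]
  \<comment> \<open>The factor \<open>1\<close> matches \<open>ptrace1_affine\<close> with
    \<open>s = 1\<close>; the same lemma is used later with \<open>s = 1 / (1 - l)\<close>.\<close>
  have BB: "B ** transpose B = 1 *\<^sub>R (C - l *\<^sub>R mat 1)"
    using assms(8) by simp
  have "trace (B ** transpose B) = trace (ptrace1 (B ** transpose B))"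
    by (simp only: trace_ptrace1)
  also have "\<dots> = (1 - l) * (real CARD('p2) * real CARD('p1))"
    unfolding BB ptrace1_affine pt by (simp add: trace_def mat_def algebra_simps)
  finally have tr: "(\<Sum>i\<in>UNIV. \<Sum>j\<in>UNIV. (B $ i $ j)\<^sup>2) = (1 - l) * (real CARD('p2) * real CARD('p1))"
    by (simp only: trace_mult_transpose)
  \<comment> \<open>The cardinality of \<open>'r\<close> is positive, whereas the zero matrix has
    rank 0.\<close>
  have "B \<noteq> 0"
    using assms(6) by (metis rank_0 zero_less_card_finite less_irrefl)
  then obtain i j where "B $ i $ j \<noteq> 0"
    by (auto simp: vec_eq_iff)
  then have "0 < (\<Sum>i\<in>UNIV. \<Sum>j\<in>UNIV. (B $ i $ j)\<^sup>2)"
    by (intro sum_pos2[of _ i] sum_pos2[of _ j] sum_nonneg) auto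
  with tr have l: "l < 1"
    by (simp add: zero_less_mult_iff mult_less_0_iff)
  define A where "A = (1 / sqrt (1 - l)) *\<^sub>R B"
  have AA: "A ** transpose A = (1 / (1 - l)) *\<^sub>R (B ** transpose B)"
    using l by (simp add: A_def matrix_matrix_mult_def transpose_def vec_eq_iff sum_distrib_left
        real_sqrt_mult_self mult_ac flip: power2_eq_square)
  \<comment> \<open>Rank \<open>CARD('r)\<close> means injectivity of the matrix map, which survives
    scaling by a nonzero constant.\<close>
  have "inj ((*v) B)"
    using assms(6) by (simp add: full_rank_injective)
  then have "inj ((*v) A)"
    using l by (simp add: A_def inj_def scaleR_matrix_vector_assoc[symmetric])
  then have rank: "rank A = CARD('r)"
    by (simp add: full_rank_injective)
  have AC: "A ** transpose A = (1 / (1 - l)) *\<^sub>R (C - l *\<^sub>R mat 1)"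
    using AA BB by simp
  have "ptrace1 (A ** transpose A) = real CARD('p2) *\<^sub>R mat 1"
    and "ptrace2 (A ** transpose A) = real CARD('p1) *\<^sub>R mat 1"
    by (simp_all only: AC ptrace1_affine ptrace2_affine pt scaleR_mat_1_normalize[OF l])
  then have "is_rank_core CARD('r) (A ** transpose A)"
    unfolding is_rank_core_def
    by (intro conjI pos_semidef_mult_transpose rank_mult_transpose_full_rank rank)
  moreover have "B ** transpose B = (1 - l) *\<^sub>R (A ** transpose A)"
    using l by (simp add: AA)
  ultimately show ?thesis
    using rank l assms(7) by auto
qed

end
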